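(* Let $d\ge 1$, let $G$ be a finite subgroup of $\mathsf{O}(d)$, and let $\Gamma$ be any topological Burnside type for $G$. Then every connected component of the space $\mathcal{C}(\Gamma)$ of $G$-symmetric configurations (with invariant masses) of topological Burnside type $\Gamma$ contains at least one central configuration.
   Context: **Configurations.** A configuration of $n\ge 1$ particles in $\mathbb{R}^d$ is a pair $(C,m)$, where $C\subset\mathbb{R}^d$ is a set of $n$ distinct points and $m:C\to\mathbb{R}^+=(0,\infty)$ is a function (the masses). The set of these is $\mathcal{C}=\mathcal{C}(\mathbb{R}^d,n)$. Its topology and manifold structure are obtained by identifying it locally with ordered configurations $(x_1,\dots,x_n)\in(\mathbb{R}^d)^n$ of distinct points (for any choice of ordering), the mass function being taken to be locally constant. So a basic neighbourhood of $(\{x_1,\dots,x_n\},m)$ consists of the configurations $(\{y_1,\dots,y_n\},m')$ with $y_i$ in a small ball around $x_i$ (these balls being disjoint) and $m'(y_i)=m(x_i)$. In particular, along a connected component each particle keeps its mass. **Symmetric configurations.** $g\in\mathsf{O}(d)$ acts by $g\cdot(C,m)=(gC,\,m\circ g^{-1})$. For a finite subgroup $G<\mathsf{O}(d)$, a configuration is ($G$-)symmetric if $g\cdot(C,m)=(C,m)$ for all $g\in G$, i.e. $gC=C$ and $m(gx)=m(x)$ for all $g\in G$, $x\in C$. The set of symmetric configurations is $\mathcal{C}^G$. **Topological Burnside type.** For $x\in\mathbb{R}^d$ let $G_x=\{g\in G: gx=x\}$. The orbit $G\cdot x$ has orbit type $(H)$ if $G_x$ is conjugate in $G$ to $H$;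 here $(H)$ denotes the conjugacy class of $H$. Let $X_H\subset\mathbb{R}^d/G$ be the set of orbits of type $(H)$, with the subspace topology of the quotient topology, and let $X_H^\alpha$ be its connected components (with $\alpha$ in an index set depending on $(H)$). An orbit belonging to $X_H^\alpha$ is said to have topological type $(H)^\alpha$. A topological Burnside type for $G$ is a nonzero formal finite sum $\Gamma=\sum a_H^\alpha (H)^\alpha$ with $a_H^\alpha\in\mathbb{N}=\{0,1,2,\dots\}$ (where $a_H^\alpha\in\{0,1\}$ when $\{x\in\mathbb{R}^d: hx=x\ \forall h\in H\}=\{0\}$). $\mathcal{C}(\Gamma)$ is the set of symmetric configurations $(C,m)$ such that $C$ consists, for each $(H)^\alpha$, of exactly $a_H^\alpha$ orbits of topological type $(H)^\alpha$ (so $n$ is determined by $\Gamma$). It has the subspace topology from $\mathcal{C}$. **Central configurations.** For a configuration $(C,m)$ put $$U(C)=\sum_{\{x,y\}\subset C}\frac{m(x)m(y)}{\|x-y\|},\qquad I(C)=\sum_{x\in C}m(x)\|x\|^2,$$ where the first sum is over unordered pairs of distinct points of $C$. A configuration $(C,m)$ is central if its centre of mass is at the origin, $\sum_{x\in C}m(x)x=0$, and it is a critical point of the restriction of $U$ to the level set of $I$ (in $\mathcal{C}$) containing it. (If $C=\{0\}$ this level set is a single point locally, and the configuration counts as central.) *)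

theory Defs
  imports "HOL-Analysis.Analysis" "HOL-Algebra.Group_Action" "HOL-Library.Multiset"
begin

section \<open>Configurations\<close>

text \<open>A mass function on \<open>C\<close> is extensional (\<open>undefined\<close> outside \<open>C\<close>), so that equality of pairs
  is equality of configurations.\<close>

type_synonym 'd config = "(real^'d) set \<times> (real^'d \<Rightarrow> real)"

definition configurations :: "nat \<Rightarrow> 'd::finite config set" where
  "configurations n = {(C, m). finite C \<and> card C = n \<and> m \<in> C \<rightarrow>\<^sub>E {0<..}}"

text \<open>The configuration in which the particle at \<open>x \<in> C\<close> has been moved to \<open>q x\<close>, keeping its mass.
  It is meaningful for \<open>q\<close> injective on \<open>C\<close>. For \<open>q\<close> close to the identity, the points
  \<open>q x\<close> \<open>(x \<in> C)\<close> are the local coordinates on the manifold of configurations around \<open>(C, m)\<close>.\<close>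

definition displace :: "'d::finite config \<Rightarrow> (real^'d \<Rightarrow> real^'d) \<Rightarrow> 'd config" where
  "displace c q = (q ` fst c, restrict (\<lambda>y. snd c (inv_into (fst c) q y)) (q ` fst c))"

definition config_nbhd :: "'d::finite config \<Rightarrow> real \<Rightarrow> 'd config set" where
  "config_nbhd c \<epsilon> = {displace c q | q. \<forall>x\<in>fst c. q x \<in> ball x \<epsilon>}"

definition config_topology :: "nat \<Rightarrow> 'd::finite config topology" where
  "config_topology n = topology_generated_by
     {config_nbhd c \<epsilon> | c \<epsilon>. c \<in> configurations n \<and> \<epsilon> > 0 \<and>
        disjoint_family_on (\<lambda>x. ball x \<epsilon>) (fst c)}"

lemma displace_self:
  assumes "c \<in> configurations n"
  shows "displace c (\<lambda>x. x) = c"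
proof -
  obtain C m where c: "c = (C, m)" by (cases c)
  have m: "m \<in> extensional C" using assms by (auto simp: c configurations_def PiE_def)
  have "restrict (\<lambda>y. m (inv_into C (\<lambda>x. x) y)) C = restrict m C"
    by (intro restrict_ext) (metis f_inv_into_f image_ident)
  then show ?thesis using m by (simp add: c displace_def extensional_restrict)
qed

lemma displace_in_configurations:
  assumes c: "c \<in> configurations n" and q: "inj_on q (fst c)"
  shows "displace c q \<in> configurations n"
  using assms by (auto simp: configurations_def displace_def card_image)

lemma topspace_config_topology: "topspace (config_topology n) = configurations n"
proof -
  have 1: "displace c q \<in> configurations n"
    if "c \<in> configurations n" "disjoint_family_on (\<lambda>x. ball x \<epsilon>) (fst c)"
      "\<forall>x\<in>fst c. q x \<in> ball x \<epsilon>" for c :: "'a config" and q \<epsilon>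
  proof (rule displace_in_configurations[OF that(1)], rule inj_onI)
    fix x y assume xy: "x \<in> fst c" "y \<in> fst c" "q x = q y"
    then have "q x \<in> ball x \<epsilon> \<inter> ball y \<epsilon>" using that(3) by (metis IntI)
    then show "x = y" using that(2) xy unfolding disjoint_family_on_def by blast
  qed
  have 2: "\<exists>\<epsilon>>0. disjoint_family_on (\<lambda>x. ball x \<epsilon>) (fst c) \<and> c \<in> config_nbhd c \<epsilon>"
    if c: "c \<in> configurations n" for c :: "'a config"
  proof -
    have fin: "finite (fst c)" using c by (auto simp: configurations_def)
    define D where "D = insert 1 ((\<lambda>(x, y). dist x y) ` {(x, y) \<in> fst c \<times> fst c. x \<noteq> y})"
    have "finite {(x, y) \<in> fst c \<times> fst c. x \<noteq> y}"
      by (rule finite_subset[of _ "fst c \<times> fst c"]) (use fin in auto)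
    then have D: "finite D" "D \<noteq> {}" "\<forall>r\<in>D. r > 0" by (auto simp: D_def)
    define \<epsilon> where "\<epsilon> = Min D / 2"
    have pos: "\<epsilon> > 0" using D by (simp add: \<epsilon>_def)
    have "2 * \<epsilon> \<le> dist x y" if "x \<in> fst c" "y \<in> fst c" "x \<noteq> y" for x y
    proof -
      have "dist x y \<in> D" using that by (force simp: D_def)
      then show ?thesis using D by (simp add: \<epsilon>_def)
    qed
    then have "disjoint_family_on (\<lambda>x. ball x \<epsilon>) (fst c)"
      unfolding disjoint_family_on_def by (auto intro!: disjoint_ballI)
    moreover have "c \<in> config_nbhd c \<epsilon>"
      unfolding config_nbhd_def using displace_self[OF c] pos
      by (intro CollectI exI[of _ "\<lambda>x. x"]) auto
    ultimately show ?thesis using pos by blast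
  qed
  show ?thesis
    unfolding config_topology_def topology_generated_by_topspace
  proof (intro equalityI subsetI)
    fix c :: "'a config"
    assume "c \<in> \<Union>{config_nbhd c \<epsilon> | c \<epsilon>. c \<in> configurations n \<and> \<epsilon> > 0 \<and>
      disjoint_family_on (\<lambda>x. ball x \<epsilon>) (fst c)}"
    then obtain c' \<epsilon> where c': "c' \<in> configurations n"
      "disjoint_family_on (\<lambda>x. ball x \<epsilon>) (fst c')" "c \<in> config_nbhd c' \<epsilon>"
      by blast
    then obtain q where "c = displace c' q" "\<forall>x\<in>fst c'. q x \<in> ball x \<epsilon>"
      unfolding config_nbhd_def by blast
    then show "c \<in> configurations n" using 1[OF c'(1,2)] by blast
  next
    fix c :: "'a config" assume "c \<in> configurations n"
    with 2[OF this] show "c \<in> \<Union>{config_nbhd c \<epsilon> | c \<epsilon>. c \<in> configurations n \<and>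
      \<epsilon> > 0 \<and> disjoint_family_on (\<lambda>x. ball x \<epsilon>) (fst c)}"
      by blast
  qed
qed

section \<open>Symmetric configurations\<close>

definition orthogonal_group :: "(real^'d::finite^'d) monoid" where
  "orthogonal_group = \<lparr>carrier = {A. orthogonal_matrix A}, mult = (**), one = mat 1\<rparr>"

lemma group_orthogonal_group: "group orthogonal_group"
proof (rule groupI)
  fix A :: "real^'d^'d" assume A: "A \<in> carrier orthogonal_group"
  show "\<exists>B\<in>carrier orthogonal_group. B \<otimes>\<^bsub>orthogonal_group\<^esub> A = \<one>\<^bsub>orthogonal_group\<^esub>"
    using A by (intro bexI[of _ "transpose A"])
      (auto simp: orthogonal_group_def orthogonal_matrix_def)
qed (auto simp: orthogonal_group_def orthogonal_matrix_mul orthogonal_matrix_id matrix_mul_assoc)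

definition subgroup_monoid :: "(real^'d::finite^'d) set \<Rightarrow> (real^'d^'d) monoid" where
  "subgroup_monoid G = orthogonal_group\<lparr>carrier := G\<rparr>"

definition config_act :: "real^'d::finite^'d \<Rightarrow> 'd config \<Rightarrow> 'd config" where
  "config_act g c =
     ((\<lambda>x. g *v x) ` fst c,
      restrict (\<lambda>y. snd c (matrix_inv g *v y)) ((\<lambda>x. g *v x) ` fst c))"

definition symmetric_configurations ::
    "nat \<Rightarrow> (real^'d::finite^'d) set \<Rightarrow> 'd config set" where
  "symmetric_configurations n G = {c \<in> configurations n. \<forall>g\<in>G. config_act g c = c}"

section \<open>Topological Burnside types\<close>

definition vec_orbit :: "(real^'d::finite^'d) set \<Rightarrow> real^'d \<Rightarrow> (real^'d) set" where
  "vec_orbit G x = orbit (subgroup_monoid G) (\<lambda>g x. g *v x) x"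

definition vec_stabilizer ::
    "(real^'d::finite^'d) set \<Rightarrow> real^'d \<Rightarrow> (real^'d^'d) set" where
  "vec_stabilizer G x = stabilizer (subgroup_monoid G) (\<lambda>g x. g *v x) x"

definition conjugacy_class ::
    "(real^'d::finite^'d) set \<Rightarrow> (real^'d^'d) set \<Rightarrow> (real^'d^'d) set set" where
  "conjugacy_class G H =
     {g <#\<^bsub>subgroup_monoid G\<^esub> H #>\<^bsub>subgroup_monoid G\<^esub> (inv\<^bsub>subgroup_monoid G\<^esub> g) | g. g \<in> G}"

definition fixed_points :: "(real^'d::finite^'d) set \<Rightarrow> (real^'d) set" where
  "fixed_points H = {x. \<forall>h\<in>H. h *v x = x}"

definition orbit_space :: "(real^'d::finite^'d) set \<Rightarrow> (real^'d) set topology" where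
  "orbit_space G = topology (\<lambda>U. U \<subseteq> range (vec_orbit G) \<and> open (vec_orbit G -` U))"

lemma openin_orbit_space:
  "openin (orbit_space G) U \<longleftrightarrow> U \<subseteq> range (vec_orbit G) \<and> open (vec_orbit G -` U)"
proof -
  have "istopology (\<lambda>U. U \<subseteq> range (vec_orbit G) \<and> open (vec_orbit G -` U))"
    by (auto simp: istopology_def vimage_Union intro!: open_UN)
  then show ?thesis
    by (simp add: orbit_space_def)
qed

lemma topspace_orbit_space: "topspace (orbit_space G) = range (vec_orbit G)"
proof -
  have "vec_orbit G -` range (vec_orbit G) = UNIV"
    by auto
  then have "openin (orbit_space G) (range (vec_orbit G))"
    by (simp add: openin_orbit_space)
  then show ?thesis
    by (meson openin_orbit_space openin_subset openin_topspace subset_antisym)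
qed

lemma quotient_map_vec_orbit: "quotient_map euclidean (orbit_space G) (vec_orbit G)"
  by (auto simp: quotient_map_def topspace_orbit_space openin_orbit_space vimage_def)

text \<open>The set of orbits whose orbit type is the conjugacy class \<open>\<H>\<close> of subgroups of \<open>G\<close>.\<close>

definition orbit_stratum ::
    "(real^'d::finite^'d) set \<Rightarrow> (real^'d^'d) set set \<Rightarrow> (real^'d) set set" where
  "orbit_stratum G \<H> = {vec_orbit G x | x. vec_stabilizer G x \<in> \<H>}"

text \<open>The topological type \<open>(H)\<^sup>\<alpha>\<close> is encoded by the conjugacy class of \<open>H\<close> together with the
  connected component itself, so no separate index \<open>\<alpha>\<close> is needed.\<close>

type_synonym 'd top_type = "(real^'d^'d) set set \<times> (real^'d) set set"

definition topological_types :: "(real^'d::finite^'d) set \<Rightarrow> 'd top_type set" where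
  "topological_types G =
     {(conjugacy_class G H, K) | H K. subgroup H (subgroup_monoid G) \<and>
        K \<in> connected_components_of
              (subtopology (orbit_space G) (orbit_stratum G (conjugacy_class G H)))}"

text \<open>A formal finite sum with natural number coefficients is a multiset; the coefficient of \<open>t\<close>
  in \<open>\<Gamma>\<close> is \<open>count \<Gamma> t\<close>.\<close>

definition topological_burnside_type ::
    "(real^'d::finite^'d) set \<Rightarrow> 'd top_type multiset \<Rightarrow> bool" where
  "topological_burnside_type G \<Gamma> \<longleftrightarrow>
     \<Gamma> \<noteq> {#} \<and> set_mset \<Gamma> \<subseteq> topological_types G \<and>
     (\<forall>H K. subgroup H (subgroup_monoid G) \<longrightarrow> (conjugacy_class G H, K) \<in> topological_types G \<longrightarrow>
        fixed_points H = {0} \<longrightarrow> count \<Gamma> (conjugacy_class G H, K) \<in> {0, 1})"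

text \<open>Each orbit has a topological type, so \<open>C\<close> is the union of the orbits counted here. The set is
  nonempty for at most one \<open>n\<close>.\<close>

definition configurations_of_type ::
    "nat \<Rightarrow> (real^'d::finite^'d) set \<Rightarrow> 'd top_type multiset \<Rightarrow> 'd config set" where
  "configurations_of_type n G \<Gamma> =
     {c \<in> symmetric_configurations n G.
        \<forall>(\<H>, K)\<in>topological_types G. card (vec_orbit G ` fst c \<inter> K) = count \<Gamma> (\<H>, K)}"

section \<open>Central configurations\<close>

text \<open>The sum over ordered pairs counts every unordered pair twice.\<close>

definition potential :: "'d::finite config \<Rightarrow> real" where
  "potential c =
     (\<Sum>x\<in>fst c. \<Sum>y\<in>fst c - {x}. snd c x * snd c y / norm (x - y)) / 2"

definition moment_of_inertia :: "'d::finite config \<Rightarrow> real" where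
  "moment_of_inertia c = (\<Sum>x\<in>fst c. snd c x * (norm x)\<^sup>2)"

text \<open>\<open>f\<close> restricted to \<open>S\<close> is critical at \<open>c\<close>: along every curve in \<open>S\<close> through \<open>c\<close> that is
  differentiable at \<open>c\<close> (in the local coordinates around \<open>c\<close>), the derivative of \<open>f\<close> at \<open>c\<close> is
  zero. When \<open>S\<close> is a submanifold, the velocities of these curves are the tangent vectors of \<open>S\<close>
  at \<open>c\<close>.\<close>

definition critical_point_on ::
    "'d::finite config set \<Rightarrow> ('d config \<Rightarrow> real) \<Rightarrow> 'd config \<Rightarrow> bool" where
  "critical_point_on S f c \<longleftrightarrow> c \<in> S \<and>
     (\<forall>q :: real \<Rightarrow> real^'d \<Rightarrow> real^'d.
        (\<forall>x\<in>fst c. q 0 x = x \<and> (\<lambda>t. q t x) differentiable (at 0)) \<longrightarrow>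
        (\<forall>\<^sub>F t in nhds 0. displace c (q t) \<in> S) \<longrightarrow>
        ((\<lambda>t. f (displace c (q t))) has_real_derivative 0) (at 0))"

definition central_configuration :: "nat \<Rightarrow> 'd::finite config \<Rightarrow> bool" where
  "central_configuration n c \<longleftrightarrow> c \<in> configurations n \<and>
     (\<Sum>x\<in>fst c. snd c x *\<^sub>R x) = 0 \<and>
     critical_point_on {c' \<in> configurations n. moment_of_inertia c' = moment_of_inertia c}
       potential c"

end

theory Submission
  imports Defs
begin

text \<open>
  Let \<open>c = (C, m)\<close> be a configuration in the given component \<open>K\<close>. The symmetric configurations that
  can be reached from \<open>c\<close> are described by the injective equivariant maps \<open>p\<close> on \<open>C\<close>: the particle
  at \<open>x\<close> is moved to \<open>p x\<close>. These maps form an open part of the finite-dimensional space of all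
  equivariant maps on \<open>C\<close>; let \<open>W\<close> be the connected component of the identity in it.

  For \<open>p \<in> W\<close> the stabilizers of \<open>x\<close> and \<open>p x\<close> coincide, since \<open>p\<close> is injective and equivariant. So
  the orbit of \<open>p x\<close> stays within one stratum of the orbit space while \<open>p\<close> runs through the
  connected set \<open>W\<close>, hence within one component of that stratum, and the topological type is
  constant on \<open>W\<close>. Moreover the displaced configuration depends continuously on \<open>p\<close>. Therefore the
  configurations obtained from \<open>W\<close> all lie in \<open>K\<close> (lemma \<open>displace_in_component\<close>).

  On \<open>W\<close> the function \<open>U + I\<close> attains its minimum: a bound on \<open>I\<close> confines the particles to a bounded
  region, and a bound on \<open>U\<close> keeps them apart, so that limits of maps in \<open>W\<close> with bounded
  \<open>U + I\<close> are again injective and hence in \<open>W\<close> (lemma \<open>energy_attains_min_on_component\<close>).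

  Let \<open>p\<close> be a minimum. As \<open>U + I\<close> is invariant under \<open>G\<close>, its gradient at \<open>p\<close>, taken in the space
  of all maps on \<open>C\<close>, is itself equivariant. So it is a direction in which \<open>p\<close> can be moved inside
  \<open>W\<close>, and the derivative in this direction, the squared length of the gradient, must vanish
  (lemma \<open>gradient_zero_at_min\<close>, an instance of the principle of symmetric criticality). Thus \<open>p\<close>
  is a critical point of \<open>U + I\<close> without any symmetry constraint. Then \<open>dU = - dI\<close> vanishes along every
  level set of \<open>I\<close>. The contributions of \<open>U\<close> to the sum of all components of the gradient
  cancel in pairs, so that the sum is twice the total \<open>\<Sum> m(x) p(x)\<close>, which must therefore vanish. So
  the displaced configuration is central (lemma \<open>central_configuration_displace\<close>).
\<close>

section \<open>Potential and moment of inertia in coordinates\<close>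

definition pair_potential :: "'a set \<Rightarrow> ('a \<Rightarrow> real) \<Rightarrow> ('a \<Rightarrow> 'b::real_inner) \<Rightarrow> real" where
  "pair_potential C m p = (\<Sum>x\<in>C. \<Sum>y\<in>C - {x}. m x * m y / norm (p x - p y)) / 2"

definition weighted_inertia :: "'a set \<Rightarrow> ('a \<Rightarrow> real) \<Rightarrow> ('a \<Rightarrow> 'b::real_inner) \<Rightarrow> real" where
  "weighted_inertia C m p = (\<Sum>x\<in>C. m x * (norm (p x))\<^sup>2)"

text \<open>The summand for \<open>y = x\<close> is zero, so summation over all of \<open>C\<close> does no harm; it makes the double sums
  below symmetric in \<open>x\<close> and \<open>y\<close>.\<close>

definition potential_gradient ::
    "'a set \<Rightarrow> ('a \<Rightarrow> real) \<Rightarrow> ('a \<Rightarrow> 'b::real_inner) \<Rightarrow> 'a \<Rightarrow> 'b" where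
  "potential_gradient C m p x =
     - (\<Sum>y\<in>C. (m x * m y / norm (p x - p y) ^ 3) *\<^sub>R (p x - p y))"

lemma inverse_norm_has_real_derivative:
  fixes w :: "real \<Rightarrow> 'b::real_inner"
  assumes w: "(w has_vector_derivative w') (at 0)" and nz: "w 0 \<noteq> 0"
  shows "((\<lambda>t. a / norm (w t)) has_real_derivative - a * (w 0 \<bullet> w') / norm (w 0) ^ 3) (at 0)"
proof -
  have "((\<lambda>t. w t \<bullet> w t) has_derivative (\<lambda>h. w 0 \<bullet> (h *\<^sub>R w') + (h *\<^sub>R w') \<bullet> w 0)) (at 0)"
    using w unfolding has_vector_derivative_def by (auto intro!: derivative_eq_intros)
  then have sq: "((\<lambda>t. w t \<bullet> w t) has_real_derivative 2 * (w 0 \<bullet> w')) (at 0)"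
    by (rule has_derivative_imp_has_field_derivative) (simp add: inner_commute)
  have "((\<lambda>t. sqrt (w t \<bullet> w t)) has_real_derivative
      inverse (sqrt (w 0 \<bullet> w 0)) / 2 * (2 * (w 0 \<bullet> w'))) (at 0)"
    using nz by (intro DERIV_chain2[OF DERIV_real_sqrt sq]) simp
  then have "((\<lambda>t. norm (w t)) has_real_derivative (w 0 \<bullet> w') / norm (w 0)) (at 0)"
    unfolding norm_eq_sqrt_inner by (simp only: divide_inverse) (simp add: algebra_simps)
  from DERIV_divide[OF DERIV_const this, of a] show ?thesis
    using nz by (simp add: power3_eq_cube mult.assoc)
qed

text \<open>The derivative of a sum of pair interactions involves relative velocities. By exchanging the names
  \<open>x\<close> and \<open>y\<close> in half of it, one collects the terms belonging to each single particle; the result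
  shows that \<open>potential_gradient\<close> is indeed the gradient.\<close>

lemma sum_inner_antisymmetric:
  fixes a :: "'a \<Rightarrow> 'a \<Rightarrow> 'b::real_inner"
  assumes anti: "\<And>x y. a y x = - a x y"
  shows "(\<Sum>x\<in>C. \<Sum>y\<in>C. a x y \<bullet> (v x - v y)) = 2 * (\<Sum>x\<in>C. (\<Sum>y\<in>C. a x y) \<bullet> v x)"
proof -
  have "(\<Sum>x\<in>C. \<Sum>y\<in>C. a x y \<bullet> v y) = (\<Sum>x\<in>C. \<Sum>y\<in>C. a y x \<bullet> v x)"
    by (rule sum.swap)
  also have "\<dots> = - (\<Sum>x\<in>C. \<Sum>y\<in>C. a x y \<bullet> v x)"
    unfolding sum_negf[symmetric] by (intro sum.cong refl) (metis anti inner_minus_left)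
  finally show ?thesis
    by (simp add: inner_diff_right sum_subtractf inner_sum_left)
qed

lemma pair_potential_has_real_derivative:
  fixes p :: "real \<Rightarrow> 'a \<Rightarrow> 'b::real_inner"
  assumes fin: "finite C" and inj: "inj_on (p 0) C"
    and v: "\<And>x. x \<in> C \<Longrightarrow> ((\<lambda>t. p t x) has_vector_derivative v x) (at 0)"
  shows "((\<lambda>t. pair_potential C m (p t)) has_real_derivative
           (\<Sum>x\<in>C. potential_gradient C m (p 0) x \<bullet> v x)) (at 0)"
proof -
  define a where "a x y = - (m x * m y / norm (p 0 x - p 0 y) ^ 3) *\<^sub>R (p 0 x - p 0 y)" for x y
  have "((\<lambda>t. m x * m y / norm (p t x - p t y)) has_real_derivative a x y \<bullet> (v x - v y)) (at 0)"
    if "x \<in> C" "y \<in> C - {x}" for x y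
  proof -
    have "p 0 x \<noteq> p 0 y" using inj that by (auto dest: inj_onD)
    moreover have "((\<lambda>t. p t x - p t y) has_vector_derivative v x - v y) (at 0)"
      using that by (intro has_vector_derivative_diff v) auto
    ultimately show ?thesis
      using inverse_norm_has_real_derivative[of "\<lambda>t. p t x - p t y" "v x - v y" "m x * m y"]
      by (simp add: a_def)
  qed
  then have "((\<lambda>t. pair_potential C m (p t)) has_real_derivative
      (\<Sum>x\<in>C. \<Sum>y\<in>C - {x}. a x y \<bullet> (v x - v y)) / 2) (at 0)"
    unfolding pair_potential_def by (intro DERIV_cdivide DERIV_sum) auto
  also have "(\<Sum>x\<in>C. \<Sum>y\<in>C - {x}. a x y \<bullet> (v x - v y)) = (\<Sum>x\<in>C. \<Sum>y\<in>C. a x y \<bullet> (v x - v y))"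
    by (intro sum.cong refl sum.mono_neutral_left) (use fin in auto)
  also have "\<dots> = 2 * (\<Sum>x\<in>C. (\<Sum>y\<in>C. a x y) \<bullet> v x)"
  proof (rule sum_inner_antisymmetric)
    show "a y x = - a x y" for x y
      by (simp add: a_def norm_minus_commute[of "p 0 x"] mult.commute scaleR_right_diff_distrib)
  qed
  finally show ?thesis
    by (simp add: potential_gradient_def a_def sum_negf)
qed

lemma weighted_inertia_has_real_derivative:
  fixes p :: "real \<Rightarrow> 'a \<Rightarrow> 'b::real_inner"
  assumes v: "\<And>x. x \<in> C \<Longrightarrow> ((\<lambda>t. p t x) has_vector_derivative v x) (at 0)"
  shows "((\<lambda>t. weighted_inertia C m (p t)) has_real_derivative
           (\<Sum>x\<in>C. (2 * m x) *\<^sub>R p 0 x \<bullet> v x)) (at 0)"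
  unfolding weighted_inertia_def power2_norm_eq_inner
proof (rule DERIV_sum)
  fix x assume "x \<in> C"
  from v[OF this] have "((\<lambda>t. m x * (p t x \<bullet> p t x)) has_derivative
      (\<lambda>h. m x * (p 0 x \<bullet> (h *\<^sub>R v x) + (h *\<^sub>R v x) \<bullet> p 0 x))) (at 0)"
    unfolding has_vector_derivative_def by (auto intro!: derivative_eq_intros)
  then show "((\<lambda>t. m x * (p t x \<bullet> p t x)) has_real_derivative (2 * m x) *\<^sub>R p 0 x \<bullet> v x) (at 0)"
    by (rule has_derivative_imp_has_field_derivative) (simp add: inner_commute)
qed

text \<open>The forces between two particles are opposite to each other. This places the centre of mass of a
  critical point at the origin.\<close>

lemma sum_potential_gradient: "(\<Sum>x\<in>C. potential_gradient C m p x) = 0"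
proof -
  define a where "a x y = (m x * m y / norm (p x - p y) ^ 3) *\<^sub>R (p x - p y)" for x y
  have anti: "a y x = - a x y" for x y
    by (simp add: a_def norm_minus_commute[of "p x"] mult.commute scaleR_right_diff_distrib)
  have "(\<Sum>x\<in>C. \<Sum>y\<in>C. a x y) = (\<Sum>x\<in>C. \<Sum>y\<in>C. a y x)" by (rule sum.swap)
  also have "\<dots> = - (\<Sum>x\<in>C. \<Sum>y\<in>C. a x y)"
    unfolding sum_negf[symmetric] by (intro sum.cong refl) (rule anti)
  finally have "2 *\<^sub>R (\<Sum>x\<in>C. \<Sum>y\<in>C. a x y) = 0"
    unfolding scaleR_2 eq_neg_iff_add_eq_0 .
  then have "(\<Sum>x\<in>C. \<Sum>y\<in>C. a x y) = 0" by simp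
  then show ?thesis by (simp add: potential_gradient_def a_def sum_negf)
qed

section \<open>Displacing configurations\<close>

lemma displace_eqI:
  assumes q: "inj_on q C" and r: "inj_on r D" and im: "q ` C = r ` D"
    and mass: "\<And>x y. x \<in> C \<Longrightarrow> y \<in> D \<Longrightarrow> q x = r y \<Longrightarrow> m x = m' y"
  shows "displace (C, m) q = displace (D, m') r"
proof -
  have "restrict (\<lambda>z. m (inv_into C q z)) (q ` C) = restrict (\<lambda>z. m' (inv_into D r z)) (q ` C)"
    by (intro restrict_ext mass) (use im in \<open>auto simp: inv_into_into f_inv_into_f\<close>)
  then show ?thesis using im by (simp add: displace_def)
qed

lemma displace_cong:
  assumes "inj_on q (fst c)" and "\<And>x. x \<in> fst c \<Longrightarrow> q x = r x"
  shows "displace c q = displace c r"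
proof (cases c)
  case (Pair C m)
  have "inj_on r C" using assms inj_on_cong[of C q r] by (simp add: Pair)
  then show ?thesis
    unfolding Pair by (intro displace_eqI) (use assms in \<open>auto simp: Pair inj_on_def image_def\<close>)
qed

lemma fst_displace: "fst (displace c q) = q ` fst c"
  by (simp add: displace_def)

lemma snd_displace:
  assumes "inj_on q (fst c)" "x \<in> fst c"
  shows "snd (displace c q) (q x) = snd c x"
  using assms by (simp add: displace_def)

lemma displace_displace:
  assumes q: "inj_on q (fst c)" and r: "inj_on r (q ` fst c)"
  shows "displace (displace c q) r = displace c (r \<circ> q)"
proof -
  have "displace (q ` fst c, snd (displace c q)) r = displace (fst c, snd c) (r \<circ> q)"
    using q r snd_displace[OF q] by (intro displace_eqI comp_inj_on) (auto dest: inj_onD)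
  then show ?thesis by (metis fst_displace prod.collapse)
qed

lemma potential_displace:
  assumes "inj_on q (fst c)"
  shows "potential (displace c q) = pair_potential (fst c) (snd c) q"
proof -
  have "(\<Sum>z\<in>q ` fst c - {q x}. snd (displace c q) (q x) * snd (displace c q) z / norm (q x - z))
      = (\<Sum>y\<in>fst c - {x}. snd c x * snd c y / norm (q x - q y))" if "x \<in> fst c" for x
  proof -
    have "q ` fst c - {q x} = q ` (fst c - {x})"
      using assms that by (auto dest: inj_onD)
    moreover have "inj_on q (fst c - {x})" using assms by (rule inj_on_diff)
    ultimately show ?thesis
      using assms that by (simp add: sum.reindex snd_displace)
  qed
  then show ?thesis
    using assms by (simp add: potential_def pair_potential_def fst_displace sum.reindex)
qed

lemma moment_of_inertia_displace:
  assumes "inj_on q (fst c)"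
  shows "moment_of_inertia (displace c q) = weighted_inertia (fst c) (snd c) q"
  using assms
  by (simp add: moment_of_inertia_def weighted_inertia_def sum.reindex snd_displace
      fst_displace)

text \<open>Two particles that are moved to the same point would lower the number of points.\<close>

lemma inj_on_if_displace_in_configurations:
  assumes "c \<in> configurations n" "displace c q \<in> configurations n"
  shows "inj_on q (fst c)"
  using assms by (auto simp: configurations_def displace_def intro!: eq_card_imp_inj_on)

text \<open>The gradient condition says that \<open>- 1\<close> is a Lagrange multiplier: \<open>U\<close> and \<open>- I\<close> have the same
  derivative along every curve. Curves through the displaced configuration are pulled back along \<open>q\<close>
  to curves of maps on the points of \<open>c\<close>, so that a single set of coordinates suffices.\<close>

lemma central_configuration_displace:
  assumes c: "c \<in> configurations n" and q: "inj_on q (fst c)"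
    and grad: "\<And>x. x \<in> fst c \<Longrightarrow>
      potential_gradient (fst c) (snd c) q x + (2 * snd c x) *\<^sub>R q x = 0"
  shows "central_configuration n (displace c q)"
proof -
  define c' where "c' = displace c q"
  have c': "c' \<in> configurations n" and fst': "fst c' = q ` fst c" and fin: "finite (fst c)"
    using displace_in_configurations[OF c q] c
    by (auto simp: c'_def displace_def configurations_def)
  have grad': "potential_gradient (fst c) (snd c) q x = - ((2 * snd c x) *\<^sub>R q x)"
    if "x \<in> fst c" for x
    using grad[OF that] by (simp add: eq_neg_iff_add_eq_0)
  have "2 *\<^sub>R (\<Sum>x\<in>fst c. snd c x *\<^sub>R q x) = (\<Sum>x\<in>fst c. (2 * snd c x) *\<^sub>R q x)"
    by (simp add: scaleR_sum_right)
  also have "\<dots> = - (\<Sum>x\<in>fst c. potential_gradient (fst c) (snd c) q x)"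
    by (simp add: grad' sum_negf)
  finally have "(\<Sum>x\<in>fst c. snd c x *\<^sub>R q x) = 0"
    by (simp add: sum_potential_gradient)
  then have com: "(\<Sum>z\<in>fst c'. snd c' z *\<^sub>R z) = 0"
    using q by (simp add: fst' sum.reindex) (simp add: c'_def snd_displace)
  have "critical_point_on {b \<in> configurations n. moment_of_inertia b = moment_of_inertia c'}
       potential c'"
    unfolding critical_point_on_def
  proof (intro conjI allI impI)
    fix r :: "real \<Rightarrow> real^'a \<Rightarrow> real^'a"
    assume r: "\<forall>x\<in>fst c'. r 0 x = x \<and> (\<lambda>t. r t x) differentiable at 0"
      and ev: "\<forall>\<^sub>F t in nhds 0. displace c' (r t) \<in>
        {b \<in> configurations n. moment_of_inertia b = moment_of_inertia c'}"
    \<comment> \<open>The curve in the coordinates around \<open>c\<close> instead of \<open>c'\<close>.\<close>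
    define p where "p t = r t \<circ> q" for t
    define v where "v x = vector_derivative (\<lambda>t. p t x) (at 0)" for x
    have v: "((\<lambda>t. p t x) has_vector_derivative v x) (at 0)" if "x \<in> fst c" for x
      unfolding v_def using r that
      by (intro vector_derivative_works[THEN iffD1]) (auto simp: p_def fst')
    have p0: "p 0 x = q x" if "x \<in> fst c" for x
      using r that by (auto simp: p_def fst')
    have inj0: "inj_on (p 0) (fst c)" using q p0 by (simp add: inj_on_def)
    have ev': "\<forall>\<^sub>F t in nhds 0. potential (displace c' (r t)) = pair_potential (fst c) (snd c) (p t)
        \<and> weighted_inertia (fst c) (snd c) (p t) = moment_of_inertia c'"
      using ev
    proof eventually_elim
      case (elim t)
      have inj: "inj_on (r t) (q ` fst c)"
        using inj_on_if_displace_in_configurations[OF c'] elim fst' by auto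
      have "displace c' (r t) = displace c (p t)"
        using displace_displace[OF q inj] by (simp add: c'_def p_def)
      moreover have "inj_on (p t) (fst c)"
        unfolding p_def using q inj by (rule comp_inj_on)
      ultimately show ?case
        using elim potential_displace[of "p t" c] moment_of_inertia_displace[of "p t" c] by simp
    qed
    have "((\<lambda>t. weighted_inertia (fst c) (snd c) (p t)) has_real_derivative
        (\<Sum>x\<in>fst c. (2 * snd c x) *\<^sub>R p 0 x \<bullet> v x)) (at 0)"
      by (rule weighted_inertia_has_real_derivative[OF v])
    moreover have "\<forall>\<^sub>F t in nhds 0. weighted_inertia (fst c) (snd c) (p t) = moment_of_inertia c'"
      using ev' by (rule eventually_mono) blast
    then have "((\<lambda>t. weighted_inertia (fst c) (snd c) (p t)) has_real_derivative 0) (at 0)"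
      by (subst DERIV_cong_ev[OF refl _ refl]) auto
    ultimately have I0: "(\<Sum>x\<in>fst c. (2 * snd c x) *\<^sub>R p 0 x \<bullet> v x) = 0"
      by (rule DERIV_unique)
    have "potential_gradient (fst c) (snd c) (p 0) x = potential_gradient (fst c) (snd c) q x"
      if "x \<in> fst c" for x
      using that by (simp add: potential_gradient_def p0)
    then have "(\<Sum>x\<in>fst c. potential_gradient (fst c) (snd c) (p 0) x \<bullet> v x)
        = - (\<Sum>x\<in>fst c. (2 * snd c x) *\<^sub>R p 0 x \<bullet> v x)"
      by (simp add: grad' p0 sum_negf)
    then have "((\<lambda>t. pair_potential (fst c) (snd c) (p t)) has_real_derivative 0) (at 0)"
      using pair_potential_has_real_derivative[OF fin inj0 v, of "snd c"] I0 by simp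
    moreover have "\<forall>\<^sub>F t in nhds 0.
        potential (displace c' (r t)) = pair_potential (fst c) (snd c) (p t)"
      using ev' by (rule eventually_mono) blast
    ultimately show "((\<lambda>t. potential (displace c' (r t))) has_real_derivative 0) (at 0)"
      by (simp add: DERIV_cong_ev[OF refl _ refl])
  qed (use c' in auto)
  with c' com show ?thesis by (simp add: central_configuration_def c'_def)
qed

text \<open>The map \<open>\<sigma>\<close> tells which particle of \<open>b\<close> is close to a given particle of \<open>c\<close> after the displacement. For
  fixed \<open>\<sigma>\<close>, the right-hand side depends on \<open>p\<close> only through finitely many open conditions, which
  gives the continuity of \<open>displace c\<close> in \<open>p\<close>.\<close>

lemma displace_in_config_nbhd_iff:
  assumes c: "c \<in> configurations n" and b: "b \<in> configurations n"
    and disj: "disjoint_family_on (\<lambda>x. ball x \<epsilon>) (fst b)" and p: "inj_on p (fst c)"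
  shows "displace c p \<in> config_nbhd b \<epsilon> \<longleftrightarrow>
    (\<exists>\<sigma>. bij_betw \<sigma> (fst c) (fst b) \<and> (\<forall>x\<in>fst c. snd b (\<sigma> x) = snd c x) \<and>
         (\<forall>x\<in>fst c. p x \<in> ball (\<sigma> x) \<epsilon>))" (is "_ \<longleftrightarrow> ?rhs")
proof
  assume "displace c p \<in> config_nbhd b \<epsilon>"
  then obtain r where eq: "displace c p = displace b r" and r: "\<forall>y\<in>fst b. r y \<in> ball y \<epsilon>"
    unfolding config_nbhd_def by blast
  have inj_r: "inj_on r (fst b)"
    using inj_on_if_displace_in_configurations[OF b] displace_in_configurations[OF c p]
    by (simp add: eq)
  have im: "p ` fst c = r ` fst b"
    using arg_cong[OF eq, of fst] by (simp add: displace_def)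
  define \<sigma> where "\<sigma> = inv_into (fst b) r \<circ> p"
  have bij: "bij_betw \<sigma> (fst c) (fst b)"
    unfolding \<sigma>_def using p im inj_r
    by (intro bij_betw_trans[of p _ "r ` fst b"] bij_betw_inv_into)
      (auto simp: bij_betw_def)
  moreover have r\<sigma>: "r (\<sigma> x) = p x" if "x \<in> fst c" for x
    unfolding \<sigma>_def comp_def using im that by (intro f_inv_into_f) blast
  have \<sigma>: "\<sigma> x \<in> fst b" if "x \<in> fst c" for x
    using bij that by (rule bij_betw_apply)
  moreover have "snd b (\<sigma> x) = snd c x" if "x \<in> fst c" for x
    using snd_displace[OF p that] snd_displace[OF inj_r \<sigma>[OF that]] by (simp add: eq r\<sigma> that)
  moreover have "p x \<in> ball (\<sigma> x) \<epsilon>" if "x \<in> fst c" for x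
    using r \<sigma>[OF that] r\<sigma>[OF that] by metis
  ultimately show ?rhs by blast
next
  assume ?rhs
  then obtain \<sigma> where bij: "bij_betw \<sigma> (fst c) (fst b)"
    and mass: "\<And>x. x \<in> fst c \<Longrightarrow> snd b (\<sigma> x) = snd c x"
    and near: "\<And>x. x \<in> fst c \<Longrightarrow> p x \<in> ball (\<sigma> x) \<epsilon>" by blast
  define \<tau> where "\<tau> = inv_into (fst c) \<sigma>"
  have \<tau>: "bij_betw \<tau> (fst b) (fst c)" unfolding \<tau>_def using bij by (rule bij_betw_inv_into)
  have \<sigma>\<tau>: "\<sigma> (\<tau> y) = y" if "y \<in> fst b" for y
    using bij that by (simp add: \<tau>_def bij_betw_inv_into_right)
  have \<tau>c: "\<tau> y \<in> fst c" if "y \<in> fst b" for y using \<tau> that by (rule bij_betw_apply)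
  have "displace (fst c, snd c) p = displace (fst b, snd b) (p \<circ> \<tau>)"
  proof (rule displace_eqI)
    show "inj_on (p \<circ> \<tau>) (fst b)"
      using \<tau> p by (intro comp_inj_on) (auto simp: bij_betw_def)
    show "p ` fst c = (p \<circ> \<tau>) ` fst b"
      using \<tau> by (simp add: bij_betw_def flip: image_image)
    show "snd c x = snd b y" if "x \<in> fst c" "y \<in> fst b" "p x = (p \<circ> \<tau>) y" for x y
    proof -
      have "x = \<tau> y" using p that \<tau>c by (auto dest: inj_onD)
      then show ?thesis using mass[OF that(1)] \<sigma>\<tau>[OF that(2)] by simp
    qed
  qed (rule p)
  moreover have "(p \<circ> \<tau>) y \<in> ball y \<epsilon>" if "y \<in> fst b" for y
    using near[OF \<tau>c[OF that]] \<sigma>\<tau>[OF that] by simp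
  ultimately show "displace c p \<in> config_nbhd b \<epsilon>"
    unfolding config_nbhd_def by auto
qed

lemma continuous_map_displace:
  fixes c :: "'d::finite config"
  assumes c: "c \<in> configurations n"
  shows "continuous_map (top_of_set {p. inj_on p (fst c)}) (config_topology n) (displace c)"
  unfolding config_topology_def
proof (rule continuous_on_generated_topo)
  have fin: "finite (fst c)" using c by (auto simp: configurations_def)
  fix U :: "'d config set"
  assume "U \<in> {config_nbhd b \<epsilon> | b \<epsilon>. b \<in> configurations n \<and> \<epsilon> > 0 \<and>
        disjoint_family_on (\<lambda>x. ball x \<epsilon>) (fst b)}"
  then obtain b \<epsilon> where U: "U = config_nbhd b \<epsilon>" and b: "b \<in> configurations n"
    and disj: "disjoint_family_on (\<lambda>x. ball x \<epsilon>) (fst b)" by blast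
  define V where "V \<sigma> = {p. \<forall>x\<in>fst c. p x \<in> ball (\<sigma> x) \<epsilon>}" for \<sigma> :: "real^'d \<Rightarrow> real^'d"
  have V: "open (V \<sigma>)" for \<sigma>
  proof -
    have "open ((\<lambda>p. p x) -` ball (\<sigma> x) \<epsilon>)" for x :: "real^'d"
      by (rule open_vimage) simp_all
    moreover have "V \<sigma> = (\<Inter>x\<in>fst c. (\<lambda>p. p x) -` ball (\<sigma> x) \<epsilon>)" by (auto simp: V_def)
    ultimately show ?thesis using fin by (simp add: open_INT)
  qed
  have "displace c -` U \<inter> {p. inj_on p (fst c)} = {p. inj_on p (fst c)} \<inter>
      (\<Union>\<sigma>\<in>{\<sigma>. bij_betw \<sigma> (fst c) (fst b) \<and> (\<forall>x\<in>fst c. snd b (\<sigma> x) = snd c x)}. V \<sigma>)"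
    using displace_in_config_nbhd_iff[OF c b disj] unfolding U V_def by blast
  then show "openin (top_of_set {p. inj_on p (fst c)})
      (displace c -` U \<inter> topspace (top_of_set {p. inj_on p (fst c)}))"
    using V by (metis (no_types, lifting) openin_open_Int open_UN topspace_euclidean_subtopology)
next
  show "displace c ` topspace (top_of_set {p. inj_on p (fst c)}) \<subseteq>
      \<Union> {config_nbhd b \<epsilon> | b \<epsilon>. b \<in> configurations n \<and> \<epsilon> > 0 \<and>
        disjoint_family_on (\<lambda>x. ball x \<epsilon>) (fst b)}"
    using displace_in_configurations[OF c]
    unfolding topspace_config_topology[of n, unfolded config_topology_def
        topology_generated_by_topspace] by auto
qed

section \<open>Existence of a minimum of the energy\<close>

text \<open>The values outside \<open>C\<close> are set to \<open>0\<close>, so that the product topology on functions restricts to the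
  usual one on the maps on \<open>C\<close>, and boundedness at each point of \<open>C\<close> gives relative compactness.\<close>

definition equivariant_embeddings ::
    "(real^'d::finite^'d) set \<Rightarrow> (real^'d) set \<Rightarrow> (real^'d \<Rightarrow> real^'d) set" where
  "equivariant_embeddings G C =
     {p. (\<forall>x. x \<notin> C \<longrightarrow> p x = 0) \<and> (\<forall>g\<in>G. \<forall>x\<in>C. p (g *v x) = g *v p x) \<and> inj_on p C}"

text \<open>Adding \<open>I\<close> to \<open>U\<close> replaces the constraint that \<open>I\<close> is constant: it bounds the sublevel sets, and at a
  critical point of the sum, the multiplier of \<open>I\<close> is known.\<close>

definition energy :: "'a set \<Rightarrow> ('a \<Rightarrow> real) \<Rightarrow> ('a \<Rightarrow> 'b::real_inner) \<Rightarrow> real" where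
  "energy C m p = pair_potential C m p + weighted_inertia C m p"

text \<open>Low energy confines the particles and keeps them apart, so that the maps whose energy is at most that of
  \<open>p\<^sub>0\<close> lie in a compact subset of the component, on which the energy is continuous.\<close>

lemma energy_attains_min_on_component:
  fixes G :: "(real^'d::finite^'d) set" and m :: "real^'d \<Rightarrow> real"
  assumes fin: "finite C" and m: "\<And>x. x \<in> C \<Longrightarrow> m x > 0"
    and p\<^sub>0: "p\<^sub>0 \<in> equivariant_embeddings G C"
  shows "\<exists>p\<in>connected_component_set (equivariant_embeddings G C) p\<^sub>0.
    \<forall>q\<in>connected_component_set (equivariant_embeddings G C) p\<^sub>0. energy C m p \<le> energy C m q"
proof -
  define W where "W = connected_component_set (equivariant_embeddings G C) p\<^sub>0"
  define e where "e = energy C m p\<^sub>0"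
  \<comment> \<open>Closed conditions that hold at energy at most \<open>e\<close>. The last one is the bound
    \<open>m x * m y / norm (q x - q y) \<le> e\<close>, multiplied out so that it stays meaningful, and fails,
    at a collision; hence injectivity follows from it.\<close>
  define Z where "Z = {q :: real^'d \<Rightarrow> real^'d. (\<forall>x. x \<notin> C \<longrightarrow> q x = 0) \<and>
    (\<forall>g. g \<in> G \<longrightarrow> (\<forall>x. x \<in> C \<longrightarrow> q (g *v x) = g *v q x)) \<and>
    (\<forall>x. x \<in> C \<longrightarrow> m x * (norm (q x))\<^sup>2 \<le> e) \<and>
    (\<forall>x. x \<in> C \<longrightarrow> (\<forall>y. y \<in> C - {x} \<longrightarrow> m x * m y \<le> e * norm (q x - q y)))}"
  have W: "W \<subseteq> equivariant_embeddings G C"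
    unfolding W_def by (rule connected_component_subset)
  have p\<^sub>0W: "p\<^sub>0 \<in> W" unfolding W_def using p\<^sub>0 by simp
  have Z_embeds: "Z \<subseteq> equivariant_embeddings G C"
  proof
    fix q assume q: "q \<in> Z"
    have "q x \<noteq> q y" if "x \<in> C" "y \<in> C" "x \<noteq> y" for x y
    proof
      assume "q x = q y"
      then have "m x * m y \<le> 0" using q that by (force simp: Z_def)
      then show False using m[OF that(1)] m[OF that(2)] by (simp add: mult_le_0_iff)
    qed
    then show "q \<in> equivariant_embeddings G C"
      using q by (auto simp: Z_def equivariant_embeddings_def inj_on_def)
  qed
  have low_energy: "q \<in> Z" if q: "q \<in> W" and le: "energy C m q \<le> e" for q
  proof -
    have E: "q \<in> equivariant_embeddings G C" using q W by blast
    have nonneg: "0 \<le> m x * (norm (q x))\<^sup>2" "y \<in> C \<Longrightarrow> 0 \<le> m x * m y / norm (q x - q y)"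
      if "x \<in> C" for x y
      using m that by (simp_all add: less_imp_le)
    have U0: "0 \<le> pair_potential C m q" and I0: "0 \<le> weighted_inertia C m q"
      unfolding pair_potential_def weighted_inertia_def using nonneg
      by (auto intro!: sum_nonneg)
    have "m x * (norm (q x))\<^sup>2 \<le> e" if "x \<in> C" for x
    proof -
      have "m x * (norm (q x))\<^sup>2 \<le> weighted_inertia C m q"
        unfolding weighted_inertia_def by (rule member_le_sum) (use that fin nonneg in auto)
      then show ?thesis using le U0 by (simp add: energy_def)
    qed
    moreover have "m x * m y \<le> e * norm (q x - q y)" if xy: "x \<in> C" "y \<in> C - {x}" for x y
    proof -
      define u where "u a b = m a * m b / norm (q a - q b)" for a b
      have u0: "0 \<le> u a b" if "a \<in> C" "b \<in> C" for a b
        using nonneg that by (simp add: u_def)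
      have row: "0 \<le> (\<Sum>b\<in>C - {a}. u a b)" if "a \<in> C" for a
        using that u0 by (intro sum_nonneg) auto
      \<comment> \<open>The pair occurs twice in the double sum, which makes up for the factor \<open>1 / 2\<close>.\<close>
      have "u x y \<le> (\<Sum>b\<in>C - {x}. u x b)"
        by (rule member_le_sum) (use xy fin u0 in auto)
      moreover have "u y x \<le> (\<Sum>b\<in>C - {y}. u y b)"
        by (rule member_le_sum) (use xy fin u0 in auto)
      moreover have "(\<Sum>b\<in>C - {x}. u x b) + (\<Sum>b\<in>C - {y}. u y b)
          = (\<Sum>a\<in>{x, y}. \<Sum>b\<in>C - {a}. u a b)"
        using xy by (subst sum.insert) auto
      moreover have "\<dots> \<le> (\<Sum>a\<in>C. \<Sum>b\<in>C - {a}. u a b)"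
        by (rule sum_mono2) (use xy fin row in auto)
      moreover have "u y x = u x y" by (simp add: u_def norm_minus_commute mult.commute)
      ultimately have "u x y \<le> (\<Sum>a\<in>C. \<Sum>b\<in>C - {a}. u a b) / 2" by linarith
      then have "u x y \<le> pair_potential C m q" by (simp add: pair_potential_def u_def)
      then have "m x * m y / norm (q x - q y) \<le> e" using le I0 by (simp add: energy_def u_def)
      moreover have "q x \<noteq> q y"
        using E xy by (auto simp: equivariant_embeddings_def dest: inj_onD)
      ultimately show ?thesis by (simp add: divide_le_eq)
    qed
    ultimately show ?thesis
      using E by (simp add: Z_def equivariant_embeddings_def)
  qed
  have coord: "continuous_on S (\<lambda>q :: real^'d \<Rightarrow> real^'d. q x)" for S x
    by (rule continuous_on_subset[OF continuous_on_product_coordinates]) simp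
  have "closed Z"
    unfolding Z_def
    by (intro closed_Collect_conj closed_Collect_all closed_Collect_imp open_Collect_const
        closed_Collect_eq closed_Collect_le continuous_intros coord
        bounded_linear.continuous_on[OF matrix_vector_mul_bounded_linear])
  \<comment> \<open>A component is closed only relative to the embeddings, which need not form a closed set; but \<open>Z\<close>
    is closed and consists of embeddings.\<close>
  moreover obtain T where "closed T" and T: "W = equivariant_embeddings G C \<inter> T"
    using closedin_connected_component[of "equivariant_embeddings G C" p\<^sub>0]
    unfolding W_def closedin_closed by blast
  moreover have "W \<inter> Z = Z \<inter> T" using T Z_embeds by blast
  ultimately have closed: "closed (W \<inter> Z)" by (simp add: closed_Int)
  define P where "P = (\<Pi>\<^sub>E x\<in>UNIV. if x \<in> C then cball (0 :: real^'d) (sqrt (e / m x)) else {0})"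
  have "compactin (product_topology (\<lambda>_. euclidean) UNIV) P"
    unfolding P_def compactin_PiE by simp
  then have "compact P" by (simp add: euclidean_product_topology)
  moreover have "W \<inter> Z \<subseteq> P"
  proof
    fix q assume q: "q \<in> W \<inter> Z"
    have "norm (q x) \<le> sqrt (e / m x)" if "x \<in> C" for x
    proof (rule real_le_rsqrt)
      show "(norm (q x))\<^sup>2 \<le> e / m x"
        using q that m by (simp add: Z_def pos_le_divide_eq mult.commute)
    qed
    then show "q \<in> P" using q by (auto simp: P_def Z_def)
  qed
  ultimately have "compact (W \<inter> Z)"
    using closed by (metis compact_Int_closed inf.absorb_iff2)
  moreover have "p\<^sub>0 \<in> W \<inter> Z" using p\<^sub>0W low_energy by (simp add: e_def)
  moreover have "continuous_on (W \<inter> Z) (energy C m)"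
    unfolding energy_def pair_potential_def weighted_inertia_def
  proof (intro continuous_intros coord)
    fix x y assume xy: "x \<in> C" "y \<in> C - {x}"
    show "\<forall>q\<in>W \<inter> Z. norm (q x - q y) \<noteq> 0"
      using W xy by (auto simp: equivariant_embeddings_def dest: inj_onD)
  qed simp
  ultimately obtain p where p: "p \<in> W \<inter> Z" and min: "\<forall>q\<in>W \<inter> Z. energy C m p \<le> energy C m q"
    using continuous_attains_inf[of "W \<inter> Z" "energy C m"] by blast
  have "energy C m p \<le> energy C m q" if "q \<in> W" for q
  proof (cases "energy C m q \<le> e")
    case True
    then show ?thesis using min low_energy that by blast
  next
    case False
    moreover have "energy C m p \<le> e" unfolding e_def using min \<open>p\<^sub>0 \<in> W \<inter> Z\<close> by (rule bspec)
    ultimately show ?thesis by linarith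
  qed
  then show ?thesis using p unfolding W_def by blast
qed

section \<open>Deformations of a symmetric configuration\<close>

locale symmetric_configuration =
  fixes G :: "(real^'d::finite^'d) set" and n :: nat and c :: "'d config"
  assumes subgroup: "subgroup G orthogonal_group"
    and symmetric: "c \<in> symmetric_configurations n G"
begin

lemma configuration: "c \<in> configurations n"
  using symmetric by (simp add: symmetric_configurations_def)

lemma finite_points: "finite (fst c)" and mass_pos: "x \<in> fst c \<Longrightarrow> snd c x > 0"
  using configuration by (auto simp: configurations_def PiE_iff)

lemma orthogonal: "g \<in> G \<Longrightarrow> orthogonal_matrix g"
  using subgroup.subset[OF subgroup] by (auto simp: orthogonal_group_def)

lemma one_mem: "mat 1 \<in> G"
  using subgroup.one_closed[OF subgroup] by (simp add: orthogonal_group_def)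

lemma matrix_inv_cancel: "matrix_inv g *v (g *v x) = x" if "g \<in> G" for x
proof -
  have "matrix_inv g ** g = mat 1"
    unfolding matrix_inv_def
    using someI_ex[of "\<lambda>B. g ** B = mat 1 \<and> B ** g = mat 1"] orthogonal[OF that]
    by (auto simp: orthogonal_matrix_def)
  then show ?thesis by (simp add: matrix_vector_mul_assoc)
qed

lemma norm_act: "norm (g *v x) = norm x" if "g \<in> G"
  using orthogonal[OF that]
  by (intro orthogonal_transformation_norm) (simp add: orthogonal_transformation_matrix)

lemma image_points: "(\<lambda>x. g *v x) ` fst c = fst c" if "g \<in> G"
proof -
  have "config_act g c = c" using symmetric that by (simp add: symmetric_configurations_def)
  then show ?thesis by (metis config_act_def fst_conv)
qed

lemma act_point: "g *v x \<in> fst c" if "g \<in> G" "x \<in> fst c"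
  using image_points[OF that(1)] that(2) by blast

lemma mass_act: "snd c (g *v x) = snd c x" if "g \<in> G" "x \<in> fst c"
proof -
  have "config_act g c = c" using symmetric that by (simp add: symmetric_configurations_def)
  then have "snd c = restrict (\<lambda>y. snd c (matrix_inv g *v y)) (fst c)"
    by (metis config_act_def fst_conv snd_conv)
  then have "snd c (g *v x) = snd c (matrix_inv g *v (g *v x))"
    using act_point[OF that] by (metis restrict_apply')
  then show ?thesis by (simp add: matrix_inv_cancel that)
qed

text \<open>The function \<open>\<lambda>x. if x \<in> fst c then x else 0\<close> is the identity on the points of \<open>c\<close>, with the default
  value outside that \<open>equivariant_embeddings\<close> prescribes.\<close>

definition deformations :: "(real^'d \<Rightarrow> real^'d) set" where
  "deformations = connected_component_set (equivariant_embeddings G (fst c))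
     (\<lambda>x. if x \<in> fst c then x else 0)"

lemma rest_in_embeddings:
  "(\<lambda>x. if x \<in> fst c then x else 0) \<in> equivariant_embeddings G (fst c)"
  using act_point by (auto simp: equivariant_embeddings_def inj_on_def)

lemma rest_in_deformations: "(\<lambda>x. if x \<in> fst c then x else 0) \<in> deformations"
  using rest_in_embeddings by (simp add: deformations_def)

lemma connected_deformations: "connected deformations"
  by (simp add: deformations_def)

lemma deformations_subset: "deformations \<subseteq> equivariant_embeddings G (fst c)"
  unfolding deformations_def by (rule connected_component_subset)

lemma deformation_inj: "p \<in> deformations \<Longrightarrow> inj_on p (fst c)"
  and deformation_act: "p \<in> deformations \<Longrightarrow> g \<in> G \<Longrightarrow> x \<in> fst c \<Longrightarrow> p (g *v x) = g *v p x"
  using deformations_subset by (auto simp: equivariant_embeddings_def)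

subsection \<open>Criticality of a minimum\<close>

definition gradient :: "(real^'d \<Rightarrow> real^'d) \<Rightarrow> real^'d \<Rightarrow> real^'d" where
  "gradient p x = potential_gradient (fst c) (snd c) p x + (2 * snd c x) *\<^sub>R p x"

text \<open>Orthogonal maps preserve distances, and \<open>g\<close> permutes the points together with their masses, so that
  it carries the forces on the particle at \<open>x\<close> to the forces on the particle at \<open>g *v x\<close>.\<close>

lemma gradient_act:
  assumes p: "p \<in> deformations" and g: "g \<in> G" and x: "x \<in> fst c"
  shows "gradient p (g *v x) = g *v gradient p x"
proof -
  define f where "f x y = (snd c x * snd c y / norm (p x - p y) ^ 3) *\<^sub>R (p x - p y)" for x y
  interpret g: bounded_linear "(*v) g" by (rule matrix_vector_mul_bounded_linear)
  have f: "f (g *v x) (g *v y) = g *v f x y" if "y \<in> fst c" for y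
    using that x g p
    by (simp add: f_def mass_act deformation_act g.scaleR norm_act flip: g.diff)
  have inj: "inj_on ((*v) g) (fst c)"
    by (rule inj_on_inverseI[of _ "(*v) (matrix_inv g)"]) (simp add: matrix_inv_cancel g)
  have "(\<Sum>y\<in>fst c. f (g *v x) y) = (\<Sum>y\<in>(*v) g ` fst c. f (g *v x) y)"
    by (simp add: image_points g)
  also have "\<dots> = g *v (\<Sum>y\<in>fst c. f x y)"
    using inj f by (simp add: sum.reindex g.sum)
  finally show ?thesis
    using p g x
    by (simp add: gradient_def potential_gradient_def f_def mass_act deformation_act
        g.add g.diff g.neg g.scaleR)
qed

text \<open>Since the gradient is equivariant, a minimum \<open>p\<close> on \<open>deformations\<close> can be moved a little along its own
  gradient, forwards and backwards. The derivative of the energy in this direction is the sum of the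
  squared lengths of the gradient components.\<close>

lemma gradient_zero_at_min:
  assumes p: "p \<in> deformations"
    and min: "\<And>q. q \<in> deformations \<Longrightarrow> energy (fst c) (snd c) p \<le> energy (fst c) (snd c) q"
    and x: "x \<in> fst c"
  shows "gradient p x = 0"
proof -
  define v where "v x = (if x \<in> fst c then gradient p x else 0)" for x
  define line where "line t x = p x + t *\<^sub>R v x" for t :: real and x
  have "\<forall>\<^sub>F t in nhds 0. line t y \<noteq> line t z" if "y \<in> fst c" "z \<in> fst c - {y}" for y z
  proof -
    have "open {t. line t y \<noteq> line t z}"
      unfolding line_def by (intro open_Collect_neq continuous_intros)
    moreover have "line 0 y \<noteq> line 0 z"
      using deformation_inj[OF p] that by (auto simp: line_def dest: inj_onD)
    ultimately show ?thesis by (auto simp: eventually_nhds)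
  qed
  then have "\<forall>\<^sub>F t in nhds 0. \<forall>y\<in>fst c. \<forall>z\<in>fst c - {y}. line t y \<noteq> line t z"
    using finite_points by (intro eventually_ball_finite ballI) auto
  then obtain \<delta> where \<delta>: "\<delta> > 0"
    and sep: "\<And>t. dist t 0 < \<delta> \<Longrightarrow> \<forall>y\<in>fst c. \<forall>z\<in>fst c - {y}. line t y \<noteq> line t z"
    unfolding eventually_nhds_metric by blast
  have emb: "line t \<in> equivariant_embeddings G (fst c)" if "t \<in> ball 0 \<delta>" for t
    unfolding equivariant_embeddings_def
  proof (intro CollectI conjI ballI allI impI)
    show "line t y = 0" if "y \<notin> fst c" for y
      using that p deformations_subset by (auto simp: line_def v_def equivariant_embeddings_def)
    show "line t (g *v y) = g *v line t y" if "g \<in> G" "y \<in> fst c" for g y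
      using that p
      by (simp add: line_def v_def act_point gradient_act deformation_act
          matrix_vector_right_distrib matrix_vector_mult_scaleR)
    show "inj_on (line t) (fst c)"
      using sep[of t] that by (auto simp: inj_on_def dist_commute)
  qed
  have "connected (line ` ball 0 \<delta>)"
    by (intro connected_continuous_image convex_connected convex_ball)
      (auto simp: line_def intro!: continuous_on_coordinatewise_then_product continuous_intros)
  moreover have line0: "line 0 = p" by (simp add: line_def fun_eq_iff)
  then have "p \<in> line ` ball 0 \<delta>" using \<delta> by force
  moreover have "line ` ball 0 \<delta> \<subseteq> equivariant_embeddings G (fst c)" using emb by blast
  ultimately have "line ` ball 0 \<delta> \<subseteq> connected_component_set (equivariant_embeddings G (fst c)) p"
    by (intro connected_component_maximal)
  also have "\<dots> = deformations"
    using p connected_component_eq unfolding deformations_def by blast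
  finally have "line t \<in> deformations" if "\<bar>t\<bar> < \<delta>" for t using that by auto
  then have le: "energy (fst c) (snd c) (line 0) \<le> energy (fst c) (snd c) (line t)"
    if "\<bar>t\<bar> < \<delta>" for t using min that by (simp add: line0)
  have vel: "((\<lambda>t. line t y) has_vector_derivative v y) (at 0)" for y
    unfolding line_def by (auto intro!: derivative_eq_intros)
  have "((\<lambda>t. energy (fst c) (snd c) (line t)) has_real_derivative
      (\<Sum>y\<in>fst c. potential_gradient (fst c) (snd c) (line 0) y \<bullet> v y) +
      (\<Sum>y\<in>fst c. (2 * snd c y) *\<^sub>R line 0 y \<bullet> v y)) (at 0)"
    unfolding energy_def
    by (intro DERIV_add pair_potential_has_real_derivative weighted_inertia_has_real_derivative
        finite_points vel) (simp add: line0 deformation_inj p)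
  moreover have "(\<Sum>y\<in>fst c. potential_gradient (fst c) (snd c) (line 0) y \<bullet> v y) +
      (\<Sum>y\<in>fst c. (2 * snd c y) *\<^sub>R line 0 y \<bullet> v y) = (\<Sum>y\<in>fst c. gradient p y \<bullet> gradient p y)"
    unfolding sum.distrib[symmetric] line0
    by (intro sum.cong refl) (simp add: v_def gradient_def inner_add_left)
  ultimately have "((\<lambda>t. energy (fst c) (snd c) (line t)) has_real_derivative
      (\<Sum>y\<in>fst c. gradient p y \<bullet> gradient p y)) (at 0)" by simp
  then have "(\<Sum>y\<in>fst c. gradient p y \<bullet> gradient p y) = 0"
    using \<delta> by (rule DERIV_local_min) (use le in auto)
  then show ?thesis
    using x finite_points by (simp add: sum_nonneg_eq_0_iff)
qed

subsection \<open>Invariance of the topological type\<close>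

lemma displace_symmetric:
  assumes p: "p \<in> deformations"
  shows "displace c p \<in> symmetric_configurations n G"
  unfolding symmetric_configurations_def
proof (intro CollectI conjI ballI)
  note inj = deformation_inj[OF p]
  show "displace c p \<in> configurations n"
    using configuration inj by (rule displace_in_configurations)
  fix g assume g: "g \<in> G"
  have act: "(\<lambda>x. g *v x) ` p ` fst c = p ` fst c"
  proof -
    have "(\<lambda>x. g *v x) ` p ` fst c = p ` (\<lambda>x. g *v x) ` fst c"
      unfolding image_image by (intro image_cong refl) (simp add: deformation_act p g)
    then show ?thesis by (simp add: image_points g)
  qed
  have "snd (displace c p) (matrix_inv g *v y) = snd c (inv_into (fst c) p y)"
    if "y \<in> p ` fst c" for y
  proof -
    have "y \<in> p ` (\<lambda>x. g *v x) ` fst c" unfolding image_points[OF g] by (rule that)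
    then obtain x where x: "x \<in> fst c" "y = p (g *v x)" by auto
    then have "matrix_inv g *v y = p x"
      by (simp add: deformation_act p g matrix_inv_cancel)
    moreover have "inv_into (fst c) p y = g *v x"
      unfolding x(2) using inj act_point[OF g x(1)] by (rule inv_into_f_f)
    ultimately show ?thesis
      using snd_displace[OF inj x(1)] mass_act[OF g x(1)] by (simp only:)
  qed
  then show "config_act g (displace c p) = displace c p"
    unfolding config_act_def fst_displace act by (simp add: displace_def cong: restrict_cong)
qed

lemma vec_orbit_eq: "vec_orbit G x = (\<lambda>g. g *v x) ` G"
  by (auto simp: vec_orbit_def orbit_def subgroup_monoid_def)

lemma vec_stabilizer_eq: "vec_stabilizer G x = {g \<in> G. g *v x = x}"
  by (auto simp: vec_stabilizer_def stabilizer_def subgroup_monoid_def)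

lemma vec_orbit_subset: "x \<in> fst c \<Longrightarrow> vec_orbit G x \<subseteq> fst c"
  using act_point by (auto simp: vec_orbit_eq)

lemma vec_orbit_deformation:
  assumes "p \<in> deformations" "x \<in> fst c"
  shows "vec_orbit G (p x) = p ` vec_orbit G x"
  using assms by (auto simp: vec_orbit_eq deformation_act image_image)

text \<open>Equivariance gives one inclusion. For the other, \<open>g *v p x = p x\<close> means \<open>p (g *v x) = p x\<close>, and \<open>p\<close> is
  injective.\<close>

lemma vec_stabilizer_deformation:
  assumes "p \<in> deformations" "x \<in> fst c"
  shows "vec_stabilizer G (p x) = vec_stabilizer G x"
  using assms inj_onD[OF deformation_inj[OF assms(1)]] act_point
  by (fastforce simp: vec_stabilizer_eq simp flip: deformation_act)

text \<open>The orbits of \<open>r x\<close>, for \<open>r \<in> deformations\<close>, form a connected set in the orbit space. As stabilizers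
  do not change, this set lies in a single stratum, so it cannot leave a component of it.\<close>

lemma orbit_component_deformation:
  assumes K: "K \<in> connected_components_of
      (subtopology (orbit_space G) (orbit_stratum G \<H>))"
    and p: "p \<in> deformations" and q: "q \<in> deformations" and x: "x \<in> fst c"
    and mem: "vec_orbit G (p x) \<in> K"
  shows "vec_orbit G (q x) \<in> K"
proof -
  have "K \<subseteq> orbit_stratum G \<H>"
    using connected_components_of_subset[OF K] by simp
  then obtain z where z: "vec_orbit G z = vec_orbit G (p x)" "vec_stabilizer G z \<in> \<H>"
    using mem by (auto simp: orbit_stratum_def)
  \<comment> \<open>The stratum only provides some point \<open>z\<close> of the orbit whose stabilizer belongs to \<open>\<H>\<close>. It is
    the image of a point \<open>w\<close> in the orbit of \<open>x\<close>, which can be used in place of \<open>x\<close>.\<close>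
  have "z \<in> vec_orbit G z"
    using one_mem by (auto simp: vec_orbit_eq intro!: image_eqI[of _ _ "mat 1"])
  then obtain w where w: "w \<in> vec_orbit G x" "z = p w"
    using z(1) vec_orbit_deformation[OF p x] by auto
  have wc: "w \<in> fst c" using w(1) vec_orbit_subset[OF x] by blast
  have "p ` vec_orbit G w = p ` vec_orbit G x"
    using z(1) w(2) vec_orbit_deformation[OF p] x wc by simp
  then have orbit_w: "vec_orbit G w = vec_orbit G x"
    using inj_on_image_eq_iff[OF deformation_inj[OF p]] vec_orbit_subset x wc by blast
  have same: "vec_orbit G (r w) = vec_orbit G (r x)" if "r \<in> deformations" for r
    using that by (simp add: vec_orbit_deformation x wc orbit_w)
  have stab: "vec_stabilizer G (r w) \<in> \<H>" if "r \<in> deformations" for r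
    using z(2) by (simp add: vec_stabilizer_deformation that p wc w(2))
  define A where "A = (\<lambda>r. vec_orbit G (r x)) ` deformations"
  have "continuous_map euclidean euclidean (\<lambda>r :: real^'d \<Rightarrow> real^'d. r x)"
    by simp
  from continuous_map_compose[OF this quotient_imp_continuous_map[OF quotient_map_vec_orbit]]
  have "continuous_map euclidean (orbit_space G) (\<lambda>r. vec_orbit G (r x))"
    by (simp only: comp_def)
  then have "connectedin (orbit_space G) A"
    unfolding A_def
    by (rule connectedin_continuous_map_image) (simp add: connected_deformations)
  moreover have "A \<subseteq> orbit_stratum G \<H>"
    unfolding A_def orbit_stratum_def by (auto simp flip: same intro: stab)
  ultimately have "connectedin (subtopology (orbit_space G) (orbit_stratum G \<H>)) A"
    by (simp add: connectedin_subtopology)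
  moreover have "\<not> disjnt K A" using mem p by (auto simp: disjnt_iff A_def)
  ultimately have "A \<subseteq> K" using connected_components_of_maximal[OF K] by blast
  then show ?thesis using q by (auto simp: A_def)
qed

text \<open>A deformation maps the orbits of points of \<open>c\<close> bijectively to the orbits of displaced points and
  preserves the component of the stratum to which an orbit belongs.\<close>

lemma displace_of_type:
  assumes type: "c \<in> configurations_of_type n G \<Gamma>" and p: "p \<in> deformations"
  shows "displace c p \<in> configurations_of_type n G \<Gamma>"
  unfolding configurations_of_type_def
proof (intro CollectI conjI ballI, rule displace_symmetric[OF p], clarify)
  fix \<H> K assume t: "(\<H>, K) \<in> topological_types G"
  then have K: "K \<in> connected_components_of (subtopology (orbit_space G) (orbit_stratum G \<H>))"
    by (auto simp: topological_types_def)
  have mem: "vec_orbit G (p x) \<in> K \<longleftrightarrow> vec_orbit G x \<in> K" if "x \<in> fst c" for x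
    using orbit_component_deformation[OF K p rest_in_deformations that]
      orbit_component_deformation[OF K rest_in_deformations p that] that by auto
  have "vec_orbit G ` p ` fst c \<inter> K = (\<lambda>x. vec_orbit G (p x)) ` {x \<in> fst c. vec_orbit G x \<in> K}"
    using mem by auto
  also have "\<dots> = image p ` vec_orbit G ` {x \<in> fst c. vec_orbit G x \<in> K}"
    unfolding image_image by (intro image_cong refl) (simp add: vec_orbit_deformation p)
  also have "vec_orbit G ` {x \<in> fst c. vec_orbit G x \<in> K} = vec_orbit G ` fst c \<inter> K" by auto
  finally have "vec_orbit G ` p ` fst c \<inter> K = image p ` (vec_orbit G ` fst c \<inter> K)" .
  moreover have "inj_on (image p) (vec_orbit G ` fst c \<inter> K)"
    by (rule inj_on_subset[OF inj_on_image_Pow[OF deformation_inj[OF p]]])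
      (use vec_orbit_subset in blast)
  ultimately have "card (vec_orbit G ` p ` fst c \<inter> K) = card (vec_orbit G ` fst c \<inter> K)"
    by (simp add: card_image)
  then show "card (vec_orbit G ` fst (displace c p) \<inter> K) = count \<Gamma> (\<H>, K)"
    using type t by (auto simp: configurations_of_type_def displace_def)
qed

subsection \<open>A central configuration in the component\<close>

lemma displace_in_component:
  assumes K: "K \<in> connected_components_of
      (subtopology (config_topology n) (configurations_of_type n G \<Gamma>))"
    and "c \<in> K" and p: "p \<in> deformations"
  shows "displace c p \<in> K"
proof -
  define A where "A = displace c ` deformations"
  have type: "c \<in> configurations_of_type n G \<Gamma>"
    using connected_components_of_subset[OF K] \<open>c \<in> K\<close> by auto
  have "connectedin (top_of_set {p. inj_on p (fst c)}) deformations"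
    using deformation_inj connected_deformations by (auto simp: connectedin_subtopology)
  then have "connectedin (config_topology n) A"
    unfolding A_def
    by (rule connectedin_continuous_map_image[OF continuous_map_displace[OF configuration]])
  moreover have "A \<subseteq> configurations_of_type n G \<Gamma>"
    using displace_of_type[OF type] by (auto simp: A_def)
  ultimately have "connectedin
      (subtopology (config_topology n) (configurations_of_type n G \<Gamma>)) A"
    by (simp add: connectedin_subtopology)
  moreover have "c \<in> A"
  proof -
    have "displace c (\<lambda>x. if x \<in> fst c then x else 0) = displace c (\<lambda>x. x)"
      by (rule displace_cong) (auto simp: inj_on_def)
    then show ?thesis
      using rest_in_deformations displace_self[OF configuration] by (force simp: A_def)
  qed
  then have "\<not> disjnt K A" using \<open>c \<in> K\<close> unfolding disjnt_iff by blast
  ultimately have "A \<subseteq> K" using connected_components_of_maximal[OF K] by blast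
  then show ?thesis using p by (auto simp: A_def)
qed

lemma central_deformation:
  obtains p where "p \<in> deformations" "central_configuration n (displace c p)"
proof -
  obtain p where p: "p \<in> deformations"
    and min: "\<And>q. q \<in> deformations \<Longrightarrow> energy (fst c) (snd c) p \<le> energy (fst c) (snd c) q"
    using energy_attains_min_on_component[where m = "snd c" and C = "fst c",
        OF finite_points mass_pos rest_in_embeddings]
    unfolding deformations_def by blast
  have "central_configuration n (displace c p)"
    using gradient_zero_at_min[OF p min]
    by (intro central_configuration_displace configuration deformation_inj p)
      (simp add: gradient_def)
  with p show thesis by (rule that)
qed

end

theorem theorem1:
  fixes G :: "(real^'d::finite^'d) set"
    and \<Gamma> :: "'d top_type multiset"
    and n :: nat
    and K :: "'d config set"
  assumes "subgroup G orthogonal_group" and "finite G"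
    and "topological_burnside_type G \<Gamma>"
    and "n \<ge> 1"
    and "K \<in> connected_components_of
               (subtopology (config_topology n) (configurations_of_type n G \<Gamma>))"
  shows "\<exists>c\<in>K. central_configuration n c"
proof -
  obtain c where c: "c \<in> K"
    using nonempty_connected_components_of[OF assms(5)] by blast
  then have "c \<in> configurations_of_type n G \<Gamma>"
    using connected_components_of_subset[OF assms(5)] by auto
  then interpret symmetric_configuration G n c
    using assms(1) by (simp add: symmetric_configuration_def configurations_of_type_def)
  show ?thesis
    using central_deformation displace_in_component[OF assms(5) c] by blast
qed

end
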